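(* Let $G=(V,E)$ be a graph with at least $d+1$ vertices where $d\geq 2$. Then $$a(G,\ell_\infty^d)=\max_{(G_1,\ldots,G_d)\in\mathcal{M}(G,\ell_\infty^d)}\ \min_{i\in[d]}\ a(G_i).$$
   Context: All graphs are finite and simple; $a(H)$ is the second smallest eigenvalue of the Laplacian matrix of a graph $H$. $\ell_\infty^d=(\mathbb{R}^d,\|\cdot\|_\infty)$, $\|x\|_\infty=\max_i|x_i|$; $b_1,\ldots,b_d$ is the standard basis. A framework in $\ell_\infty^d$ is a pair $(G,p)$, $p=(p_v)_{v\in V}\in(\mathbb{R}^d)^V$, such that for every edge $vw$, $p_v\neq p_w$ and there is a unique index $i$ with $|(p_v-p_w)_i|=\|p_v-p_w\|_\infty$; $\mathcal{W}(G,\ell_\infty^d)$ is the set of such $p$. For such an edge set $\varphi_{v,w}=\operatorname{sgn}((p_v-p_w)_i)\,b_i^\top\in\mathbb{R}^{1\times d}$ (the unique support functional). The rigidity matrix $R(G,p)$ is the $|E|\times d|V|$ matrix whose row for edge $vw$ has $\varphi_{v,w}$ in the $d$ columns of $v$, $-\varphi_{v,w}$ in the $d$ columns of $w$ and zeros elsewhere; $L(G,p)=R(G,p)^\top R(G,p)$, with eigenvalues $\lambda_1\le\lambda_2\le\cdots$ counted with multiplicity. For $G$ with at least $d+1$ vertices, $a(G,\ell_\infty^d)=\sup\{\lambda_{d+1}(L(G,p)):p\in\mathcal{W}(G,\ell_\infty^d)\}$. For a framework $(G,p)$ in $\ell_\infty^d$, its monochrome subgraphs are $G_i=(V,E_i)$,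 $i\in[d]$, with $E_i=\{vw\in E:|(p_v-p_w)_i|=\|p_v-p_w\|_\infty\}$; $\mathcal{M}(G,\ell_\infty^d)$ is the set of all $d$-tuples $(G_1,\ldots,G_d)$ arising as the monochrome subgraphs of some framework $(G,p)$ in $\ell_\infty^d$. *)

theory Defs
  imports
    "Jordan_Normal_Form.Char_Poly"
    "HOL-Library.FuncSet"
    Complex_Main
begin

type_synonym 'a graph = "'a set \<times> 'a set set"

abbreviation verts :: "'a graph \<Rightarrow> 'a set" where
  "verts \<equiv> fst"

abbreviation edges :: "'a graph \<Rightarrow> 'a set set" where
  "edges \<equiv> snd"

definition finite_simple_graph :: "'a graph \<Rightarrow> bool" where
  "finite_simple_graph G \<longleftrightarrow>
     finite (verts G) \<and> (\<forall>e\<in>edges G. e \<subseteq> verts G \<and> card e = 2)"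

text \<open>
  Matrices attached to a graph are indexed through an arbitrary but fixed enumeration of the
  vertices and an arbitrary but fixed enumeration of the edges, in which each edge is listed
  exactly once, as an ordered pair of its endpoints.
\<close>

definition vertex_list :: "'a graph \<Rightarrow> 'a list" where
  "vertex_list G = (SOME vs. distinct vs \<and> set vs = verts G)"

definition edge_list :: "'a graph \<Rightarrow> ('a \<times> 'a) list" where
  "edge_list G = (SOME es. distinct (map (\<lambda>(v, w). {v, w}) es)
                         \<and> set (map (\<lambda>(v, w). {v, w}) es) = edges G)"

text \<open>
  The \<open>k\<close>-th smallest eigenvalue, \<open>k \<ge> 1\<close>, counted with multiplicity, of a real matrix. It is
  meant for symmetric matrices: there all complex eigenvalues are real, and algebraic and
  geometric multiplicities coincide.
\<close>

definition kth_eigenvalue :: "nat \<Rightarrow> real mat \<Rightarrow> real" where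
  "kth_eigenvalue k A = sorted_list_of_multiset (proots (char_poly A)) ! (k - 1)"

definition laplacian :: "'a graph \<Rightarrow> real mat" where
  "laplacian G =
     (let n = card (verts G); vs = vertex_list G in
      mat n n (\<lambda>(i, j).
        if i = j then real (card {e \<in> edges G. vs ! i \<in> e})
        else if {vs ! i, vs ! j} \<in> edges G then - 1
        else 0))"

definition algebraic_connectivity :: "'a graph \<Rightarrow> real" where
  "algebraic_connectivity G = kth_eigenvalue 2 (laplacian G)"

text \<open>Points of \<open>\<real>\<^sup>d\<close> are vectors in \<open>carrier_vec d\<close>; coordinates are indexed by \<open>{..<d}\<close>.\<close>

definition linf_norm :: "real vec \<Rightarrow> real" where
  "linf_norm x = Max ((\<lambda>i. \<bar>x $ i\<bar>) ` {..<dim_vec x})"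

definition frameworks :: "nat \<Rightarrow> 'a graph \<Rightarrow> ('a \<Rightarrow> real vec) set" where
  "frameworks d G =
     {p \<in> verts G \<rightarrow>\<^sub>E carrier_vec d.
        \<forall>v w. {v, w} \<in> edges G \<longrightarrow>
          p v \<noteq> p w \<and> (\<exists>!i. i < d \<and> \<bar>(p v - p w) $ i\<bar> = linf_norm (p v - p w))}"

definition support_functional :: "nat \<Rightarrow> ('a \<Rightarrow> real vec) \<Rightarrow> 'a \<Rightarrow> 'a \<Rightarrow> real vec" where
  "support_functional d p v w =
     (let i = (THE i. i < d \<and> \<bar>(p v - p w) $ i\<bar> = linf_norm (p v - p w))
      in sgn ((p v - p w) $ i) \<cdot>\<^sub>v unit_vec d i)"

text \<open>Column \<open>c\<close> belongs to coordinate \<open>c mod d\<close> of the vertex with index \<open>c div d\<close>.\<close>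

definition rigidity_matrix :: "nat \<Rightarrow> 'a graph \<Rightarrow> ('a \<Rightarrow> real vec) \<Rightarrow> real mat" where
  "rigidity_matrix d G p =
     mat (card (edges G)) (d * card (verts G)) (\<lambda>(r, c).
       let (v, w) = edge_list G ! r; x = vertex_list G ! (c div d) in
       if x = v then support_functional d p v w $ (c mod d)
       else if x = w then - (support_functional d p v w $ (c mod d))
       else 0)"

definition framework_laplacian :: "nat \<Rightarrow> 'a graph \<Rightarrow> ('a \<Rightarrow> real vec) \<Rightarrow> real mat" where
  "framework_laplacian d G p = transpose_mat (rigidity_matrix d G p) * rigidity_matrix d G p"

definition linf_algebraic_connectivity :: "nat \<Rightarrow> 'a graph \<Rightarrow> real" where
  "linf_algebraic_connectivity d G =
     Sup {kth_eigenvalue (d + 1) (framework_laplacian d G p) | p. p \<in> frameworks d G}"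

definition monochrome_subgraph :: "nat \<Rightarrow> 'a graph \<Rightarrow> ('a \<Rightarrow> real vec) \<Rightarrow> 'a graph" where
  "monochrome_subgraph i G p =
     (verts G,
      {{v, w} | v w. {v, w} \<in> edges G \<and> \<bar>(p v - p w) $ i\<bar> = linf_norm (p v - p w)})"

text \<open>Tuples \<open>(G\<^sub>1, \<dots>, G\<^sub>d)\<close> are lists of length \<open>d\<close>.\<close>

definition monochrome_tuples :: "nat \<Rightarrow> 'a graph \<Rightarrow> 'a graph list set" where
  "monochrome_tuples d G =
     {map (\<lambda>i. monochrome_subgraph i G p) [0..<d] | p. p \<in> frameworks d G}"

end

theory Submission
  imports Defs "HOL-Computational_Algebra.Fundamental_Theorem_Algebra"
begin

text \<open>
  Each row of the rigidity matrix is supported on the single coordinate in which its edge attains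
  the norm, so after grouping columns by coordinate the framework Laplacian is block diagonal, with
  the ordinary Laplacians of the monochrome subgraphs as blocks. Its spectrum is therefore the
  union, with multiplicity, of theirs. Each of the \<open>d\<close> blocks has smallest eigenvalue \<open>0\<close>; once
  these \<open>d\<close> zeros are removed, the smallest remaining eigenvalue is the least of the second smallest
  eigenvalues of the blocks. There are finitely many monochrome tuples, so the supremum is a maximum.
\<close>

section \<open>Determinants and characteristic polynomials of interleaved diagonal blocks\<close>

text \<open>The sign of \<open>p\<close> enters once for the rows and once for the columns, and it
  squares to 1. Columns are reached by transposing, permuting rows and transposing back.\<close>

lemma det_permute_rows_cols:
  fixes A :: "'a :: comm_ring_1 mat"
  assumes A: "A \<in> carrier_mat n n" and p: "p permutes {0..<n}"
  shows "det (mat n n (\<lambda>(i, j). A $$ (p i, p j))) = det A"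
proof -
  define B where "B = mat n n (\<lambda>(i, j). A $$ (p i, j))"
  define C where "C = mat n n (\<lambda>(i, j). transpose_mat B $$ (p i, j))"
  have B: "B \<in> carrier_mat n n" by (simp add: B_def)
  have C: "C \<in> carrier_mat n n" by (simp add: C_def)
  have lt: "p i < n" if "i < n" for i
    using permutes_in_image[OF p, of i] that by auto
  have eq: "mat n n (\<lambda>(i, j). A $$ (p i, p j)) = transpose_mat C"
    using A lt by (intro eq_matI) (auto simp: B_def C_def)
  have "det (transpose_mat C) = det C"
    using C by (rule det_transpose)
  also have "\<dots> = signof p * det (transpose_mat B)"
    unfolding C_def using B p by (intro det_permute_rows) auto
  also have "det (transpose_mat B) = det B"
    using B by (rule det_transpose)
  also have "det B = signof p * det A"
    unfolding B_def using A p by (rule det_permute_rows)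
  also have "signof p * (signof p * det A) = det A"
    by (simp add: sign_def)
  finally show ?thesis
    using eq by simp
qed

text \<open>Induction on the number of blocks: the last block \<open>M d\<close> is split off as the
  lower right corner of a block matrix whose off-diagonal corners are zero.\<close>

lemma det_block_diagonal:
  fixes M :: "nat \<Rightarrow> 'a :: idom mat"
  assumes M: "\<And>k. k < d \<Longrightarrow> M k \<in> carrier_mat n n" and n: "n > 0"
  shows "det (mat (d * n) (d * n) (\<lambda>(i, j).
           if i div n = j div n then M (i div n) $$ (i mod n, j mod n) else 0)) =
         (\<Prod>k<d. det (M k))"
  using M
proof (induction d)
  case 0
  show ?case by simp
next
  case (Suc d)
  define B where "B d = mat (d * n) (d * n) (\<lambda>(i, j).
    if i div n = j div n then M (i div n) $$ (i mod n, j mod n) else 0)" for d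
  have lt: "i div n < d" if "i < d * n" for i
    using that n by (simp add: less_mult_imp_div_less)
  have ge: "i div n = d \<and> i mod n = i - d * n" if "\<not> i < d * n" "i < n + d * n" for i
  proof -
    have "d * n \<le> i" using that(1) by simp
    then obtain k where k: "i = d * n + k"
      using le_Suc_ex by blast
    with that show ?thesis using n by simp
  qed
  have "B (Suc d) = four_block_mat (B d) (0\<^sub>m (d * n) n) (0\<^sub>m n (d * n)) (M d)"
  proof (rule eq_matI)
    fix i j
    assume "i < dim_row (four_block_mat (B d) (0\<^sub>m (d * n) n) (0\<^sub>m n (d * n)) (M d))"
      and "j < dim_col (four_block_mat (B d) (0\<^sub>m (d * n) n) (0\<^sub>m n (d * n)) (M d))"
    then have ij: "i < n + d * n" "j < n + d * n"
      using Suc.prems[of d] by (auto simp: B_def)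
    show "B (Suc d) $$ (i, j) =
        four_block_mat (B d) (0\<^sub>m (d * n) n) (0\<^sub>m n (d * n)) (M d) $$ (i, j)"
      using ij Suc.prems[of d] lt[of i] lt[of j] ge[of i] ge[of j]
      by (cases "i < d * n"; cases "j < d * n") (auto simp: B_def)
  qed (use Suc.prems[of d] in \<open>auto simp: B_def\<close>)
  moreover have "det (four_block_mat (B d) (0\<^sub>m (d * n) n) (0\<^sub>m n (d * n)) (M d)) =
      det (B d) * det (M d)"
    using Suc.prems by (intro det_four_block_mat_upper_right_zero) (auto simp: B_def)
  ultimately have "det (B (Suc d)) = det (B d) * det (M d)" by simp
  then show ?case using Suc unfolding B_def by simp
qed

text \<open>The passage between two column orders. In vertex-major order, index \<open>i\<close>
  stands for coordinate \<open>i mod d\<close> of vertex \<open>i div d\<close>; its image is the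
  position of the same pair in coordinate-major order. Both components can be read off the image by
  \<open>div\<close> and \<open>mod\<close>, so the map is injective, and finiteness gives
  surjectivity.\<close>

lemma permutes_div_mod_swap:
  fixes d n :: nat
  assumes "d > 0" "n > 0"
  shows "(\<lambda>i. if i < d * n then (i mod d) * n + i div d else i) permutes {0..<d * n}"
    (is "?f permutes _")
proof (rule bij_imp_permutes)
  have lt: "(i mod d) * n + i div d < d * n" if "i < d * n" for i
  proof -
    have "i div d < n" using that by (simp add: less_mult_imp_div_less mult.commute)
    \<comment> \<open>An offset \<open>i div d\<close> below \<open>n\<close> keeps the image within
      block \<open>i mod d\<close>, hence below the start of the next block.\<close>
    moreover have "Suc (i mod d) * n \<le> d * n" using assms by (intro mult_right_mono) (auto simp: Suc_le_eq)
    ultimately show ?thesis by simp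
  qed
  have inj: "inj_on ?f {0..<d * n}"
  proof (rule inj_onI)
    fix i j assume i: "i \<in> {0..<d * n}" and j: "j \<in> {0..<d * n}" and eq: "?f i = ?f j"
    have div: "i div d < n" "j div d < n"
      using i j by (simp_all add: less_mult_imp_div_less mult.commute)
    have "((i mod d) * n + i div d) div n = ((j mod d) * n + j div d) div n"
         "((i mod d) * n + i div d) mod n = ((j mod d) * n + j div d) mod n"
      using eq i j by auto
    then have "i mod d = j mod d" "i div d = j div d"
      using div assms by simp_all
    then show "i = j" by (metis div_mult_mod_eq)
  qed
  have "?f ` {0..<d * n} = {0..<d * n}"
    using inj lt by (intro endo_inj_surj) auto
  with inj show "bij_betw ?f {0..<d * n} {0..<d * n}"
    by (simp add: bij_betw_def)
qed auto

text \<open>The block structure in the column numbering of the rigidity matrix: reordering rows and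
  columns by the same permutation makes the blocks contiguous and leaves the determinant
  unchanged.\<close>

lemma det_interleaved_blocks:
  fixes M :: "nat \<Rightarrow> 'a :: idom mat"
  assumes M: "\<And>k. k < d \<Longrightarrow> M k \<in> carrier_mat n n" and n: "n > 0" and d: "d > 0"
  shows "det (mat (d * n) (d * n) (\<lambda>(i, j).
           if i mod d = j mod d then M (i mod d) $$ (i div d, j div d) else 0)) =
         (\<Prod>k<d. det (M k))"
proof -
  define f where "f i = (if i < d * n then (i mod d) * n + i div d else i)" for i
  define B where "B = mat (d * n) (d * n) (\<lambda>(i, j).
    if i div n = j div n then M (i div n) $$ (i mod n, j mod n) else 0)"
  have f: "f permutes {0..<d * n}"
    unfolding f_def by (rule permutes_div_mod_swap[OF d n])
  have lt: "f i < d * n" "f i div n = i mod d" "f i mod n = i div d" if "i < d * n" for i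
  proof -
    have "i div d < n" using that by (simp add: less_mult_imp_div_less mult.commute)
    then show "f i div n = i mod d" "f i mod n = i div d"
      using that n by (simp_all add: f_def)
    show "f i < d * n" using permutes_in_image[OF f, of i] that by auto
  qed
  have "mat (d * n) (d * n) (\<lambda>(i, j).
          if i mod d = j mod d then M (i mod d) $$ (i div d, j div d) else 0) =
        mat (d * n) (d * n) (\<lambda>(i, j). B $$ (f i, f j))"
    using lt by (intro eq_matI) (auto simp: B_def)
  also have "det \<dots> = det B"
    using f by (intro det_permute_rows_cols) (auto simp: B_def)
  also have "\<dots> = (\<Prod>k<d. det (M k))"
    unfolding B_def by (rule det_block_diagonal[OF M n])
  finally show ?thesis .
qed

text \<open>Interleaving commutes with forming the characteristic matrix, so the determinant formula
  applies over the polynomial ring.\<close>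

lemma char_poly_interleaved_blocks:
  fixes M :: "nat \<Rightarrow> 'a :: idom mat"
  assumes M: "\<And>k. k < d \<Longrightarrow> M k \<in> carrier_mat n n" and n: "n > 0" and d: "d > 0"
  shows "char_poly (mat (d * n) (d * n) (\<lambda>(i, j).
           if i mod d = j mod d then M (i mod d) $$ (i div d, j div d) else 0)) =
         (\<Prod>k<d. char_poly (M k))"
proof -
  define A where "A = mat (d * n) (d * n) (\<lambda>(i, j).
           if i mod d = j mod d then M (i mod d) $$ (i div d, j div d) else 0)"
  have "char_poly_matrix A = mat (d * n) (d * n) (\<lambda>(i, j).
      if i mod d = j mod d then char_poly_matrix (M (i mod d)) $$ (i div d, j div d) else 0)"
    (is "_ = ?C")
  proof (rule eq_matI)
    fix i j assume "i < dim_row ?C" "j < dim_col ?C"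
    then have ij: "i < d * n" "j < d * n" by auto
    then have div: "i div d < n" "j div d < n"
      by (simp_all add: less_mult_imp_div_less mult.commute)
    \<comment> \<open>A diagonal entry of the large matrix is exactly a diagonal entry of one of the
      blocks, so the indeterminate appears in the right places.\<close>
    have "i = j \<longleftrightarrow> i mod d = j mod d \<and> i div d = j div d"
      by (metis div_mult_mod_eq)
    with ij div M[of "i mod d"] d
    show "char_poly_matrix A $$ (i, j) = ?C $$ (i, j)"
      by (auto simp: A_def char_poly_matrix_def)
  qed (auto simp: A_def char_poly_matrix_def)
  with det_interleaved_blocks[of d "\<lambda>k. char_poly_matrix (M k)" n] M n d
  show ?thesis by (simp add: A_def char_poly_def)
qed

section \<open>Spectra of real symmetric matrices and of matrices with zero row sums\<close>

text \<open>\<open>proots\<close> of a real polynomial collects real roots only, so its size may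
  fall short of the degree in general. Here the fundamental theorem of algebra supplies a complex
  root, which is real by hypothesis; its linear factor is split off, and the quotient inherits the
  hypothesis.\<close>

lemma size_proots_real_rooted:
  fixes p :: "real poly"
  assumes "p \<noteq> 0" and "\<And>z. poly (map_poly complex_of_real p) z = 0 \<Longrightarrow> z \<in> \<real>"
  shows "size (proots p) = degree p"
  using assms
proof (induction "degree p" arbitrary: p)
  case 0
  then show ?case using size_proots_le[of p] by simp
next
  case (Suc m)
  obtain z where z: "poly (map_poly complex_of_real p) z = 0"
    using alg_closed_imp_poly_has_root[of "map_poly complex_of_real p"] Suc.hyps(2) by auto
  with Suc.prems obtain x where "z = of_real x" by (auto elim: Reals_cases)
  with z have "poly p x = 0" by simp
  then obtain q where q: "p = [:-x, 1:] * q"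
    by (auto simp: poly_eq_0_iff_dvd dvd_def)
  with Suc.prems have q0: "q \<noteq> 0" by auto
  then have deg: "degree p = Suc (degree q)"
    unfolding q by (subst degree_mult_eq) auto
  interpret hom: map_poly_comm_ring_hom complex_of_real ..
  have mult: "map_poly complex_of_real p =
      map_poly complex_of_real [:-x, 1:] * map_poly complex_of_real q"
    unfolding q by (rule hom.hom_mult)
  have "size (proots q) = degree q"
    using Suc.hyps(2) deg q0 Suc.prems(2) by (intro Suc.hyps(1)) (auto simp: mult)
  then show ?case
    using deg q0 proots_mult[of "[:-x, 1:]" q] unfolding q by simp
qed

text \<open>For a complex eigenvector \<open>v\<close>, the Hermitian form \<open>S\<close> of
  \<open>A\<close> at \<open>v\<close> equals \<open>z\<close> times the squared norm
  \<open>r\<close> of \<open>v\<close>. Symmetry of the real matrix \<open>A\<close> makes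
  \<open>S\<close> its own conjugate, and \<open>r\<close> is nonzero, so \<open>z\<close> is
  real.\<close>

lemma symmetric_char_poly_root_real:
  fixes A :: "real mat"
  assumes A: "A \<in> carrier_mat n n"
    and sym: "\<And>i j. i < n \<Longrightarrow> j < n \<Longrightarrow> A $$ (i, j) = A $$ (j, i)"
    and root: "poly (map_poly complex_of_real (char_poly A)) z = 0"
  shows "z \<in> \<real>"
proof -
  define B where "B = map_mat complex_of_real A"
  have B: "B \<in> carrier_mat n n" using A by (simp add: B_def)
  have "char_poly B = map_poly complex_of_real (char_poly A)"
    unfolding B_def by (rule of_real_hom.char_poly_hom[OF A])
  with root have "eigenvalue B z" by (simp add: eigenvalue_root_char_poly[OF B])
  then obtain v where v: "v \<in> carrier_vec n" "v \<noteq> 0\<^sub>v n" "B *\<^sub>v v = z \<cdot>\<^sub>v v"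
    using B by (auto simp: eigenvalue_def eigenvector_def)
  have row: "(\<Sum>j<n. of_real (A $$ (i, j)) * v $ j) = z * v $ i" if "i < n" for i
  proof -
    have "(B *\<^sub>v v) $ i = (\<Sum>j<n. of_real (A $$ (i, j)) * v $ j)"
      using that A v(1) by (simp add: B_def scalar_prod_def atLeast0LessThan)
    with v that show ?thesis by simp
  qed
  define S where "S = (\<Sum>i<n. cnj (v $ i) * (\<Sum>j<n. of_real (A $$ (i, j)) * v $ j))"
  define r where "r = (\<Sum>i<n. (cmod (v $ i))\<^sup>2)"
  have "S = (\<Sum>i<n. z * of_real ((cmod (v $ i))\<^sup>2))"
    unfolding S_def by (intro sum.cong refl) (simp add: row complex_norm_square del: of_real_power)
  then have S: "S = z * of_real r"
    by (simp add: r_def sum_distrib_left)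
  have "cnj S = (\<Sum>i<n. \<Sum>j<n. v $ i * (of_real (A $$ (i, j)) * cnj (v $ j)))"
    by (simp add: S_def sum_distrib_left)
  also have "\<dots> = (\<Sum>j<n. \<Sum>i<n. v $ i * (of_real (A $$ (i, j)) * cnj (v $ j)))"
    by (rule sum.swap)
  also have "\<dots> = S"
    unfolding S_def sum_distrib_left
    by (intro sum.cong refl) (auto simp: sym)
  finally have "cnj (z * of_real r) = z * of_real r" by (simp add: S)
  then have "cnj z * of_real r = z * of_real r" by simp
  moreover have "r \<noteq> 0"
  proof
    assume "r = 0"
    then have "\<forall>i\<in>{..<n}. (cmod (v $ i))\<^sup>2 = 0"
      unfolding r_def by (subst (asm) sum_nonneg_eq_0_iff) auto
    then have "v = 0\<^sub>v n" using v(1) by (intro eq_vecI) auto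
    with v(2) show False by contradiction
  qed
  ultimately have "cnj z = z" by simp
  then show ?thesis by (simp add: Reals_cnj_iff)
qed

text \<open>Nonpositive off-diagonal entries make
  \<open>2 x\<^sup>T A x = - (\<Sum>i j. A\<^sub>i\<^sub>j (x\<^sub>i - x\<^sub>j)\<^sup>2)\<close> nonnegative.\<close>

lemma zero_row_sums_eigenvalue_nonneg:
  fixes A :: "real mat"
  assumes A: "A \<in> carrier_mat n n"
    and sym: "\<And>i j. i < n \<Longrightarrow> j < n \<Longrightarrow> A $$ (i, j) = A $$ (j, i)"
    and off: "\<And>i j. i < n \<Longrightarrow> j < n \<Longrightarrow> i \<noteq> j \<Longrightarrow> A $$ (i, j) \<le> 0"
    and rows: "\<And>i. i < n \<Longrightarrow> (\<Sum>j<n. A $$ (i, j)) = 0"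
    and ev: "eigenvalue A x"
  shows "x \<ge> 0"
proof -
  obtain v where v: "v \<in> carrier_vec n" "v \<noteq> 0\<^sub>v n" "A *\<^sub>v v = x \<cdot>\<^sub>v v"
    using ev A by (auto simp: eigenvalue_def eigenvector_def)
  have row: "(\<Sum>j<n. A $$ (i, j) * v $ j) = x * v $ i" if "i < n" for i
  proof -
    have "(A *\<^sub>v v) $ i = (\<Sum>j<n. A $$ (i, j) * v $ j)"
      using that A v(1) by (simp add: scalar_prod_def atLeast0LessThan)
    with v that show ?thesis by simp
  qed
  define r where "r = (\<Sum>i<n. (v $ i)\<^sup>2)"
  \<comment> \<open>Expanding the square gives two pure terms and a cross term. The pure terms
    vanish because rows sum to zero, the second one after a swap of the sums and symmetry; the
    eigenvalue equation turns the double sum in the cross term into \<open>x * r\<close>.\<close>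
  have "(\<Sum>i<n. \<Sum>j<n. A $$ (i, j) * (v $ i - v $ j)\<^sup>2) =
      (\<Sum>i<n. \<Sum>j<n. A $$ (i, j) * (v $ i)\<^sup>2) + (\<Sum>i<n. \<Sum>j<n. A $$ (i, j) * (v $ j)\<^sup>2)
      - 2 * (\<Sum>i<n. \<Sum>j<n. v $ i * (A $$ (i, j) * v $ j))"
    by (simp add: power2_diff algebra_simps sum.distrib sum_subtractf sum_distrib_left)
  moreover have "(\<Sum>i<n. \<Sum>j<n. A $$ (i, j) * (v $ i)\<^sup>2) = 0"
    by (simp add: sum_distrib_right[symmetric] rows)
  moreover have "(\<Sum>i<n. \<Sum>j<n. A $$ (i, j) * (v $ j)\<^sup>2) =
      (\<Sum>j<n. \<Sum>i<n. A $$ (j, i) * (v $ j)\<^sup>2)"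
    by (subst sum.swap) (intro sum.cong refl, auto simp: sym)
  moreover have "(\<Sum>j<n. \<Sum>i<n. A $$ (j, i) * (v $ j)\<^sup>2) = 0"
    by (simp add: sum_distrib_right[symmetric] rows)
  moreover have "(\<Sum>i<n. \<Sum>j<n. v $ i * (A $$ (i, j) * v $ j)) = x * r"
    by (simp add: sum_distrib_left[symmetric] row r_def)
      (simp add: sum_distrib_left power2_eq_square mult_ac)
  moreover have "(\<Sum>i<n. \<Sum>j<n. A $$ (i, j) * (v $ i - v $ j)\<^sup>2) \<le> 0"
  proof (intro sum_nonpos)
    fix i j assume "i \<in> {..<n}" "j \<in> {..<n}"
    then show "A $$ (i, j) * (v $ i - v $ j)\<^sup>2 \<le> 0"
      using off[of i j] by (cases "i = j") (auto simp: mult_nonpos_nonneg)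
  qed
  ultimately have "x * r \<ge> 0" by linarith
  moreover have "r > 0"
  proof -
    have "r \<noteq> 0"
    proof
      assume "r = 0"
      then have "\<forall>i\<in>{..<n}. (v $ i)\<^sup>2 = 0"
        unfolding r_def by (subst (asm) sum_nonneg_eq_0_iff) auto
      then have "v = 0\<^sub>v n" using v(1) by (intro eq_vecI) auto
      with v(2) show False by contradiction
    qed
    moreover have "r \<ge> 0" unfolding r_def by (intro sum_nonneg) auto
    ultimately show ?thesis by linarith
  qed
  ultimately show ?thesis by (simp add: zero_le_mult_iff)
qed

text \<open>The all-ones vector is an eigenvector, nonzero since \<open>n > 0\<close>.\<close>

lemma zero_row_sums_eigenvalue_zero:
  fixes A :: "real mat"
  assumes A: "A \<in> carrier_mat n n" and n: "n > 0"
    and rows: "\<And>i. i < n \<Longrightarrow> (\<Sum>j<n. A $$ (i, j)) = 0"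
  shows "eigenvalue A 0"
proof -
  define v :: "real vec" where "v = vec n (\<lambda>_. 1)"
  have "A *\<^sub>v v = 0 \<cdot>\<^sub>v v"
    using A rows by (intro eq_vecI) (auto simp: v_def scalar_prod_def atLeast0LessThan)
  moreover have "v \<noteq> 0\<^sub>v n"
  proof
    assume "v = 0\<^sub>v n"
    then have "v $ 0 = 0\<^sub>v n $ 0" by simp
    with n show False by (simp add: v_def)
  qed
  ultimately show ?thesis
    using A unfolding eigenvalue_def eigenvector_def by (intro exI[of _ v]) (auto simp: v_def)
qed

section \<open>Order statistics of a sum of multisets\<close>

lemma sorted_list_of_multiset_replicate_plus:
  fixes S :: "'a :: linorder multiset"
  assumes "\<And>x. x \<in># S \<Longrightarrow> a \<le> x"
  shows "sorted_list_of_multiset (replicate_mset k a + S) =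
    replicate k a @ sorted_list_of_multiset S"
proof -
  have "sorted (replicate k a @ sorted_list_of_multiset S)"
    using assms by (auto simp: sorted_append)
  then have "sorted_list_of_multiset (mset (replicate k a @ sorted_list_of_multiset S)) =
      replicate k a @ sorted_list_of_multiset S"
    by (simp only: sorted_list_of_multiset_mset sorted_sort_id)
  then show ?thesis by simp
qed

lemma sorted_list_of_multiset_nth_0:
  assumes "S \<noteq> {#}"
  shows "sorted_list_of_multiset S ! 0 = Min (set_mset S)"
proof -
  define xs where "xs = sorted_list_of_multiset S"
  have "mset xs = S" "sorted xs" by (simp_all add: xs_def)
  moreover from this have "xs \<noteq> []" using assms by auto
  ultimately have "xs ! 0 = Min (set xs)"
    by (cases xs) (auto intro!: Min_eqI[symmetric] simp del: set_mset_mset)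
  then show ?thesis by (simp add: xs_def)
qed

text \<open>Positions count from 0, so \<open>! d\<close> is the entry numbered \<open>d + 1\<close>
  and \<open>! 1\<close> is the second smallest. Exactly one copy of 0 is removed from each
  \<open>M k\<close>; the remainder \<open>R k\<close> may still contain 0. The \<open>d\<close>
  removed zeros come first in the sorted sum, so position \<open>d\<close> holds the minimum of all
  remainders together, while \<open>! 1\<close> of a single \<open>M k\<close> is the minimum of
  \<open>R k\<close>. The size bound keeps each \<open>R k\<close> nonempty.\<close>

lemma sorted_list_of_multiset_sum_nth:
  fixes M :: "nat \<Rightarrow> real multiset"
  assumes d: "d > 0"
    and zero: "\<And>k. k < d \<Longrightarrow> 0 \<in># M k"
    and nonneg: "\<And>k x. k < d \<Longrightarrow> x \<in># M k \<Longrightarrow> 0 \<le> x"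
    and size: "\<And>k. k < d \<Longrightarrow> 2 \<le> size (M k)"
  shows "sorted_list_of_multiset (\<Sum>k<d. M k) ! d =
    Min ((\<lambda>k. sorted_list_of_multiset (M k) ! 1) ` {..<d})"
proof -
  define R where "R k = M k - {#0#}" for k
  define S where "S = (\<Sum>k<d. R k)"
  have M: "M k = replicate_mset 1 0 + R k" if "k < d" for k
    using zero[OF that] by (simp add: R_def)
  have R: "0 \<le> x" if "k < d" "x \<in># R k" for k x
    using nonneg[of k x] that by (auto simp: R_def dest: in_diffD)
  have R_ne: "R k \<noteq> {#}" if "k < d" for k
    using size[OF that] M[OF that] by auto
  have nth1: "sorted_list_of_multiset (M k) ! 1 = Min (set_mset (R k))" if "k < d" for k
    unfolding M[OF that] using R[OF that] R_ne[OF that]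
    by (subst sorted_list_of_multiset_replicate_plus)
      (auto simp: nth_append sorted_list_of_multiset_nth_0[unfolded One_nat_def])
  have set_S: "set_mset S = (\<Union>k<d. set_mset (R k))"
    unfolding S_def by (simp add: set_mset_sum)
  have S_ne: "S \<noteq> {#}"
    using R_ne[OF d] d set_S by (metis UN_I lessThan_iff set_mset_eq_empty_iff empty_iff multiset_nonemptyE)
  have "(\<Sum>k<d. M k) = (\<Sum>k<d. {#0#} + R k)"
    using M by (intro sum.cong) auto
  also have "\<dots> = replicate_mset d 0 + S"
  proof -
    have "(\<Sum>k<d. {#0::real#}) = replicate_mset d 0" by (induction d) auto
    then show ?thesis by (simp only: sum.distrib S_def)
  qed
  finally have "sorted_list_of_multiset (\<Sum>k<d. M k) =
      replicate d 0 @ sorted_list_of_multiset S"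
    using R set_S by (simp only:) (rule sorted_list_of_multiset_replicate_plus, auto)
  then have "sorted_list_of_multiset (\<Sum>k<d. M k) ! d = Min (set_mset S)"
    using S_ne by (simp add: nth_append sorted_list_of_multiset_nth_0)
  \<comment> \<open>The minimum over the union of the remainders is the least of their separate
    minima.\<close>
  also have "\<dots> = Min ((\<lambda>k. Min (set_mset (R k))) ` {..<d})"
  proof (rule Min_eqI)
    show "finite (set_mset S)" by simp
  next
    fix x assume "x \<in> set_mset S"
    then obtain k where k: "k < d" "x \<in># R k" using set_S by auto
    have "Min ((\<lambda>k. Min (set_mset (R k))) ` {..<d}) \<le> Min (set_mset (R k))"
      using k by (intro Min_le) auto
    also have "\<dots> \<le> x" using k by (intro Min_le) auto
    finally show "Min ((\<lambda>k. Min (set_mset (R k))) ` {..<d}) \<le> x" .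
  next
    have "Min ((\<lambda>k. Min (set_mset (R k))) ` {..<d}) \<in> (\<lambda>k. Min (set_mset (R k))) ` {..<d}"
      using d by (intro Min_in) auto
    then obtain k where k: "k < d"
      "Min ((\<lambda>k. Min (set_mset (R k))) ` {..<d}) = Min (set_mset (R k))" by auto
    moreover have "Min (set_mset (R k)) \<in> set_mset (R k)"
      using R_ne[OF k(1)] by (intro Min_in) auto
    ultimately show "Min ((\<lambda>k. Min (set_mset (R k))) ` {..<d}) \<in> set_mset S"
      unfolding set_S by auto
  qed
  also have "\<dots> = Min ((\<lambda>k. sorted_list_of_multiset (M k) ! 1) ` {..<d})"
    using nth1 by (intro arg_cong[of _ _ Min] image_cong) auto
  finally show ?thesis .
qed

section \<open>Vertex and edge enumerations, and the spectrum of the graph Laplacian\<close>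

lemma vertex_list:
  assumes "finite (verts G)"
  shows "distinct (vertex_list G)" and "set (vertex_list G) = verts G"
proof -
  obtain vs where "distinct vs \<and> set vs = verts G"
    using finite_distinct_list[OF assms] by blast
  then have "distinct (vertex_list G) \<and> set (vertex_list G) = verts G"
    unfolding vertex_list_def by (rule someI)
  then show "distinct (vertex_list G)" and "set (vertex_list G) = verts G" by auto
qed

lemma bij_betw_vertex_list:
  assumes "finite (verts G)"
  shows "bij_betw ((!) (vertex_list G)) {..<card (verts G)} (verts G)"
  using vertex_list[OF assms] distinct_card[of "vertex_list G"]
  by (intro bij_betw_nth) auto

lemma finite_simple_graph_finite_edges:
  assumes "finite_simple_graph G"
  shows "finite (edges G)"
proof (rule finite_subset)
  show "edges G \<subseteq> Pow (verts G)" "finite (Pow (verts G))"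
    using assms by (auto simp: finite_simple_graph_def)
qed

lemma edge_list:
  assumes "finite_simple_graph G"
  shows "distinct (map (\<lambda>(v, w). {v, w}) (edge_list G))"
    and "set (map (\<lambda>(v, w). {v, w}) (edge_list G)) = edges G"
proof -
  obtain xs where xs: "distinct xs" "set xs = edges G"
    using finite_distinct_list[OF finite_simple_graph_finite_edges[OF assms]] by blast
  \<comment> \<open>A witness for the choice in \<open>edge_list\<close>: list the edges and orient
    each one arbitrarily by \<open>f\<close>.\<close>
  have "\<forall>e\<in>edges G. \<exists>vw. (\<lambda>(v, w). {v, w}) vw = e"
    using assms by (fastforce simp: finite_simple_graph_def card_2_iff)
  from bchoice[OF this] obtain f where f: "\<forall>e\<in>edges G. (\<lambda>(v, w). {v, w}) (f e) = e" ..
  have "map (\<lambda>(v, w). {v, w}) (map f xs) = xs"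
    unfolding map_map using f xs(2) by (intro map_idI) auto
  with xs have "distinct (map (\<lambda>(v, w). {v, w}) (map f xs)) \<and>
      set (map (\<lambda>(v, w). {v, w}) (map f xs)) = edges G" by (simp only:)
  then have "\<exists>es. distinct (map (\<lambda>(v, w). {v, w}) es) \<and>
      set (map (\<lambda>(v, w). {v, w}) es) = edges G" by (rule exI)
  from someI_ex[OF this] have "distinct (map (\<lambda>(v, w). {v, w}) (edge_list G)) \<and>
      set (map (\<lambda>(v, w). {v, w}) (edge_list G)) = edges G"
    unfolding edge_list_def .
  then show "distinct (map (\<lambda>(v, w). {v, w}) (edge_list G))"
    and "set (map (\<lambda>(v, w). {v, w}) (edge_list G)) = edges G" by auto
qed

text \<open>Turns a sum over rows of the rigidity matrix into a sum over edges, provided that the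
  summand depends only on the unoriented edge.\<close>

lemma sum_edge_list:
  fixes g :: "'a set \<Rightarrow> real"
  assumes G: "finite_simple_graph G"
  shows "(\<Sum>r<card (edges G). g ((\<lambda>(v, w). {v, w}) (edge_list G ! r))) = (\<Sum>e\<in>edges G. g e)"
proof -
  let ?es = "map (\<lambda>(v, w). {v, w}) (edge_list G)"
  have len: "length ?es = card (edges G)"
    using edge_list[OF G] distinct_card by metis
  have bij: "bij_betw ((!) ?es) {..<card (edges G)} (edges G)"
    using edge_list[OF G] len by (intro bij_betw_nth) auto
  have "(\<Sum>r<card (edges G). g ((\<lambda>(v, w). {v, w}) (edge_list G ! r))) =
      (\<Sum>r<card (edges G). g (?es ! r))"
    using len by (intro sum.cong) auto
  also have "\<dots> = (\<Sum>e\<in>edges G. g e)"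
    using bij by (rule sum.reindex_bij_betw)
  finally show ?thesis .
qed

lemma laplacian_carrier: "laplacian G \<in> carrier_mat (card (verts G)) (card (verts G))"
  by (simp add: laplacian_def Let_def)

lemma laplacian_index:
  assumes "i < card (verts G)" "j < card (verts G)"
  shows "laplacian G $$ (i, j) =
    (if i = j then real (card {e \<in> edges G. vertex_list G ! i \<in> e})
     else if {vertex_list G ! i, vertex_list G ! j} \<in> edges G then - 1 else 0)"
  using assms by (simp add: laplacian_def Let_def)

text \<open>The diagonal entry is the degree of \<open>x\<close>, and each neighbour contributes -1
  off the diagonal; edges at \<open>x\<close> correspond to neighbours through their other
  endpoint.\<close>

lemma laplacian_row_sum:
  assumes G: "finite_simple_graph G" and i: "i < card (verts G)"
  shows "(\<Sum>j<card (verts G). laplacian G $$ (i, j)) = 0"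
proof -
  define n where "n = card (verts G)"
  define x where "x = vertex_list G ! i"
  have fin: "finite (verts G)" using G by (simp add: finite_simple_graph_def)
  have bij: "bij_betw ((!) (vertex_list G)) {..<n} (verts G)"
    unfolding n_def by (rule bij_betw_vertex_list[OF fin])
  have inj: "vertex_list G ! i = vertex_list G ! j \<longleftrightarrow> i = j" if "j < n" for j
    using bij that i by (auto simp: bij_betw_def inj_on_def n_def)
  have x: "x \<in> verts G" using bij i by (auto simp: bij_betw_def x_def n_def)
  have "(\<Sum>j<n. laplacian G $$ (i, j)) =
      (\<Sum>j<n. (\<lambda>y. if x = y then real (card {e \<in> edges G. x \<in> e})
         else if {x, y} \<in> edges G then - 1 else 0) (vertex_list G ! j))"
    using i inj by (intro sum.cong) (auto simp: laplacian_index n_def x_def)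
  also have "\<dots> = (\<Sum>y\<in>verts G. if x = y then real (card {e \<in> edges G. x \<in> e})
         else if {x, y} \<in> edges G then - 1 else 0)"
    by (rule sum.reindex_bij_betw[OF bij])
  also have "\<dots> = real (card {e \<in> edges G. x \<in> e}) +
      (\<Sum>y\<in>verts G - {x}. if {x, y} \<in> edges G then - 1 else 0)"
    using fin x by (subst sum.remove[of _ x]) (auto intro!: sum.cong split: if_splits)
  also have "(\<Sum>y\<in>verts G - {x}. if {x, y} \<in> edges G then - 1 else 0 :: real) =
      - real (card {y \<in> verts G - {x}. {x, y} \<in> edges G})"
    using fin by (simp add: sum.If_cases Int_def)
  also have "card {y \<in> verts G - {x}. {x, y} \<in> edges G} = card {e \<in> edges G. x \<in> e}"
  proof (rule bij_betw_same_card[of "\<lambda>y. {x, y}"])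
    show "bij_betw (\<lambda>y. {x, y}) {y \<in> verts G - {x}. {x, y} \<in> edges G} {e \<in> edges G. x \<in> e}"
      unfolding bij_betw_def
    proof
      show "inj_on (\<lambda>y. {x, y}) {y \<in> verts G - {x}. {x, y} \<in> edges G}"
        by (auto simp: inj_on_def doubleton_eq_iff)
      show "(\<lambda>y. {x, y}) ` {y \<in> verts G - {x}. {x, y} \<in> edges G} = {e \<in> edges G. x \<in> e}"
      proof (intro equalityI subsetI)
        fix e assume "e \<in> {e \<in> edges G. x \<in> e}"
        then have e: "e \<in> edges G" "x \<in> e" "e \<subseteq> verts G" "card e = 2"
          using G by (auto simp: finite_simple_graph_def)
        then obtain a b where ab: "e = {a, b}" "a \<noteq> b"
          using card_2_iff by metis
        define y where "y = (if x = a then b else a)"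
        have "y \<noteq> x" "e = {x, y}" using ab e(2) by (auto simp: y_def)
        with e show "e \<in> (\<lambda>y. {x, y}) ` {y \<in> verts G - {x}. {x, y} \<in> edges G}"
          by (intro image_eqI[of _ _ y]) auto
      qed auto
    qed
  qed
  finally show ?thesis by (simp add: n_def)
qed

text \<open>Provides what \<open>sorted_list_of_multiset_sum_nth\<close> asks of each block. The
  size statement says that no eigenvalue is lost by collecting real roots only, which rests on
  symmetry.\<close>

lemma proots_char_poly_laplacian:
  assumes G: "finite_simple_graph G" and n: "card (verts G) > 0"
  shows "0 \<in># proots (char_poly (laplacian G))"
    and "x \<in># proots (char_poly (laplacian G)) \<Longrightarrow> 0 \<le> x"
    and "size (proots (char_poly (laplacian G))) = card (verts G)"
proof -
  define n where "n = card (verts G)"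
  define A where "A = laplacian G"
  have A: "A \<in> carrier_mat n n" by (simp add: A_def n_def laplacian_carrier)
  have sym: "A $$ (i, j) = A $$ (j, i)" if "i < n" "j < n" for i j
    using that by (auto simp: A_def n_def laplacian_index insert_commute)
  have off: "A $$ (i, j) \<le> 0" if "i < n" "j < n" "i \<noteq> j" for i j
    using that by (auto simp: A_def n_def laplacian_index)
  have rows: "(\<Sum>j<n. A $$ (i, j)) = 0" if "i < n" for i
    using that laplacian_row_sum[OF G] by (simp add: A_def n_def)
  have ne: "char_poly A \<noteq> 0" using degree_monic_char_poly[OF A] by auto
  have ev: "x \<in># proots (char_poly A) \<longleftrightarrow> eigenvalue A x" for x
    using ne by (simp add: eigenvalue_root_char_poly[OF A])
  have "eigenvalue A 0"
    using n by (intro zero_row_sums_eigenvalue_zero[OF A _ rows]) (auto simp: n_def)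
  then show "0 \<in># proots (char_poly (laplacian G))"
    using ev by (simp add: A_def)
  show "0 \<le> x" if "x \<in># proots (char_poly (laplacian G))"
    using that zero_row_sums_eigenvalue_nonneg[OF A sym off rows] ev by (simp add: A_def)
  have "size (proots (char_poly A)) = degree (char_poly A)"
    using ne by (rule size_proots_real_rooted) (rule symmetric_char_poly_root_real[OF A sym])
  then show "size (proots (char_poly (laplacian G))) = card (verts G)"
    using degree_monic_char_poly[OF A] by (simp add: A_def n_def)
qed

section \<open>Edges of a framework and their colours\<close>

lemma linf_norm_minus_commute:
  assumes "x \<in> carrier_vec d" "y \<in> carrier_vec d"
  shows "linf_norm (x - y) = linf_norm (y - x)"
  using assms unfolding linf_norm_def
  by (intro arg_cong[of _ _ Max] image_cong) (auto simp: abs_minus_commute)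

lemma linf_norm_pos:
  assumes "x \<in> carrier_vec d" "y \<in> carrier_vec d" "x \<noteq> y"
  shows "linf_norm (x - y) > 0"
proof -
  obtain i where i: "i < d" "x $ i \<noteq> y $ i"
    using assms by (metis carrier_vecD eq_vecI)
  then have "0 < \<bar>(x - y) $ i\<bar>" using assms by simp
  also have "\<dots> \<le> linf_norm (x - y)"
    unfolding linf_norm_def using i assms by (intro Max_ge) auto
  finally show ?thesis .
qed

lemma verts_monochrome_subgraph [simp]: "verts (monochrome_subgraph i G p) = verts G"
  by (simp add: monochrome_subgraph_def)

lemma vertex_list_monochrome_subgraph [simp]:
  "vertex_list (monochrome_subgraph i G p) = vertex_list G"
  by (simp add: vertex_list_def)

lemma edges_monochrome_subgraph_subset: "edges (monochrome_subgraph i G p) \<subseteq> edges G"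
  by (auto simp: monochrome_subgraph_def)

lemma finite_simple_graph_monochrome_subgraph:
  "finite_simple_graph G \<Longrightarrow> finite_simple_graph (monochrome_subgraph i G p)"
  using edges_monochrome_subgraph_subset[of i G p]
  by (auto simp: finite_simple_graph_def)

lemma framework_edge:
  assumes "finite_simple_graph G" "p \<in> frameworks d G" "{v, w} \<in> edges G"
  shows "p v \<in> carrier_vec d" "p w \<in> carrier_vec d" "p v \<noteq> p w" "v \<noteq> w"
    "\<exists>!i. i < d \<and> \<bar>(p v - p w) $ i\<bar> = linf_norm (p v - p w)"
proof -
  have "v \<in> verts G" "w \<in> verts G" "card {v, w} = 2"
    using assms(1,3) by (auto simp: finite_simple_graph_def)
  with assms(2,3) show "p v \<in> carrier_vec d" "p w \<in> carrier_vec d" "p v \<noteq> p w" "v \<noteq> w"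
    "\<exists>!i. i < d \<and> \<bar>(p v - p w) $ i\<bar> = linf_norm (p v - p w)"
    by (auto simp: frameworks_def)
qed

text \<open>An unordered edge may enter the subgraph through either orientation. Reversing it only
  flips the sign of the difference, so the condition can be tested on the given orientation.\<close>

lemma mem_edges_monochrome_subgraph:
  assumes G: "finite_simple_graph G" and p: "p \<in> frameworks d G" and e: "{v, w} \<in> edges G"
    and k: "k < d"
  shows "{v, w} \<in> edges (monochrome_subgraph k G p) \<longleftrightarrow>
    \<bar>(p v - p w) $ k\<bar> = linf_norm (p v - p w)"
proof -
  note vw = framework_edge[OF G p e]
  have "\<bar>(p w - p v) $ k\<bar> = \<bar>(p v - p w) $ k\<bar>"
    using vw(1,2) k by (simp add: abs_minus_commute)
  with linf_norm_minus_commute[OF vw(1,2)] e show ?thesis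
    by (fastforce simp: monochrome_subgraph_def doubleton_eq_iff)
qed

text \<open>The sign is kept abstract as \<open>s\<close>: the framework Laplacian multiplies two
  entries of the same row, so only \<open>s * s\<close> enters. It is not zero because the endpoints
  of an edge have distinct positions and hence positive distance.\<close>

lemma support_functional_index:
  assumes G: "finite_simple_graph G" and p: "p \<in> frameworks d G" and e: "{v, w} \<in> edges G"
  obtains s :: real where "s * s = 1" and "\<And>k. k < d \<Longrightarrow> support_functional d p v w $ k =
    (if {v, w} \<in> edges (monochrome_subgraph k G p) then s else 0)"
proof -
  note vw = framework_edge[OF G p e]
  define i where "i = (THE i. i < d \<and> \<bar>(p v - p w) $ i\<bar> = linf_norm (p v - p w))"
  have i: "i < d" "\<bar>(p v - p w) $ i\<bar> = linf_norm (p v - p w)"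
    using theI'[OF vw(5)] unfolding i_def by auto
  have uniq: "{v, w} \<in> edges (monochrome_subgraph k G p) \<longleftrightarrow> k = i" if "k < d" for k
    using mem_edges_monochrome_subgraph[OF G p e that] vw(5) i that by blast
  have "(p v - p w) $ i \<noteq> 0"
    using linf_norm_pos[OF vw(1-3)] i(2) by linarith
  then have "sgn ((p v - p w) $ i) * sgn ((p v - p w) $ i) = 1"
    by (simp add: sgn_if)
  moreover have "support_functional d p v w $ k =
      (if {v, w} \<in> edges (monochrome_subgraph k G p) then sgn ((p v - p w) $ i) else 0)"
    if "k < d" for k
    using that uniq[OF that] i(1)
    by (auto simp: support_functional_def Let_def i_def[symmetric] unit_vec_def)
  ultimately show thesis by (rule that)
qed

section \<open>Block structure and spectrum of the framework Laplacian\<close>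

text \<open>Each entry is a sum over edges of products of two entries in one row. Such a product
  vanishes unless both columns belong to the coordinate that colours the edge; within one
  coordinate, the rigidity matrix is, up to row signs, the oriented incidence matrix of the
  monochrome subgraph, whose Gram matrix is the Laplacian.\<close>

lemma framework_laplacian_eq:
  assumes G: "finite_simple_graph G" and p: "p \<in> frameworks d G" and d: "d > 0"
  shows "framework_laplacian d G p =
    mat (d * card (verts G)) (d * card (verts G)) (\<lambda>(i, j).
      if i mod d = j mod d
      then laplacian (monochrome_subgraph (i mod d) G p) $$ (i div d, j div d) else 0)"
    (is "_ = ?B")
proof (rule eq_matI)
  define n where "n = card (verts G)"
  define m where "m = card (edges G)"
  define E where "E k = edges (monochrome_subgraph k G p)" for k
  fix i j assume "i < dim_row ?B" "j < dim_col ?B"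
  then have ij: "i < d * n" "j < d * n" by (simp_all add: n_def)
  then have div: "i div d < n" "j div d < n"
    by (simp_all add: less_mult_imp_div_less mult.commute)
  have md: "i mod d < d" "j mod d < d" using d by simp_all
  define x where "x = vertex_list G ! (i div d)"
  define y where "y = vertex_list G ! (j div d)"
  have xy: "x = y \<longleftrightarrow> i div d = j div d"
    using bij_betw_vertex_list[of G] G div
    by (auto simp: bij_betw_def inj_on_def n_def finite_simple_graph_def x_def y_def)
  have E_sub: "E k \<subseteq> edges G" for k
    unfolding E_def by (rule edges_monochrome_subgraph_subset)
  have fin: "finite (edges G)" by (rule finite_simple_graph_finite_edges[OF G])
  have len: "length (edge_list G) = m"
    using edge_list[OF G] distinct_card unfolding m_def by (metis length_map)
  \<comment> \<open>The contribution of one edge to entry \<open>(i, j)\<close>, written so that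
    neither orientation nor sign occurs; this is the form \<open>sum_edge_list\<close>
    requires.\<close>
  define g :: "'a set \<Rightarrow> real" where "g e =
    (if i mod d = j mod d \<and> e \<in> E (i mod d)
     then (if x = y then (if x \<in> e then 1 else 0) else if e = {x, y} then -1 else 0) else 0)" for e
  have "framework_laplacian d G p $$ (i, j) =
      (\<Sum>r<m. rigidity_matrix d G p $$ (r, i) * rigidity_matrix d G p $$ (r, j))"
    using ij by (simp add: framework_laplacian_def rigidity_matrix_def scalar_prod_def
        n_def m_def atLeast0LessThan)
  also have "\<dots> = (\<Sum>r<m. g ((\<lambda>(v, w). {v, w}) (edge_list G ! r)))"
  proof (rule sum.cong[OF refl])
    fix r assume r: "r \<in> {..<m}"
    obtain v w where vw: "edge_list G ! r = (v, w)" by fastforce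
    have "(v, w) \<in> set (edge_list G)" using r len vw by (metis lessThan_iff nth_mem)
    then have e: "{v, w} \<in> edges G" using edge_list(2)[OF G] by force
    have "v \<noteq> w" by (rule framework_edge[OF G p e])
    obtain s :: real where s: "s * s = 1" and sf: "\<And>k. k < d \<Longrightarrow> support_functional d p v w $ k =
        (if {v, w} \<in> E k then s else 0)"
      unfolding E_def by (rule support_functional_index[OF G p e]) blast
    \<comment> \<open>Uniqueness of the coordinate attaining the norm: an edge has only one colour,
      so products of columns from different coordinates vanish.\<close>
    have uniq: "k = l" if "k < d" "l < d" "{v, w} \<in> E k" "{v, w} \<in> E l" for k l
      using framework_edge(5)[OF G p e] that mem_edges_monochrome_subgraph[OF G p e]
      unfolding E_def by blast
    \<comment> \<open>The signed incidence of a vertex with the oriented edge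
      \<open>(v, w)\<close>.\<close>
    define \<delta> :: "'a \<Rightarrow> real" where "\<delta> z = (if z = v then 1 else if z = w then - 1 else 0)" for z
    have R: "rigidity_matrix d G p $$ (r, c) =
        (if {v, w} \<in> E (c mod d) then s else 0) * \<delta> (vertex_list G ! (c div d))"
      if "c < d * n" for c
      using r that vw d sf by (simp add: rigidity_matrix_def m_def n_def \<delta>_def)
    have "rigidity_matrix d G p $$ (r, i) * rigidity_matrix d G p $$ (r, j) =
        (if i mod d = j mod d \<and> {v, w} \<in> E (i mod d) then s * s else 0) * (\<delta> x * \<delta> y)"
      unfolding R[OF ij(1)] R[OF ij(2)] x_def[symmetric] y_def[symmetric]
      using uniq[OF md] by (cases "i mod d = j mod d") auto
    also have "\<dots> = g {v, w}"
      using \<open>v \<noteq> w\<close> s by (auto simp: g_def \<delta>_def doubleton_eq_iff)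
    finally show "rigidity_matrix d G p $$ (r, i) * rigidity_matrix d G p $$ (r, j) =
        g ((\<lambda>(v, w). {v, w}) (edge_list G ! r))" by (simp add: vw)
  qed
  also have "\<dots> = (\<Sum>e\<in>edges G. g e)"
    unfolding m_def by (rule sum_edge_list[OF G])
  also have "\<dots> = ?B $$ (i, j)"
  proof (cases "i mod d = j mod d")
    case False
    then show ?thesis using ij by (simp add: g_def n_def)
  next
    case True
    define k where "k = i mod d"
    have B: "?B $$ (i, j) = laplacian (monochrome_subgraph k G p) $$ (i div d, j div d)"
      using True ij by (simp add: k_def n_def)
    have lap: "\<dots> = (if x = y then real (card {e \<in> E k. x \<in> e})
        else if {x, y} \<in> E k then - 1 else 0)"
      using div by (subst laplacian_index) (simp_all add: n_def E_def flip: x_def y_def xy)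
    show ?thesis
    proof (cases "x = y")
      case eq: True
      have "(\<Sum>e\<in>edges G. g e) = (\<Sum>e\<in>{e \<in> E k. x \<in> e}. 1)"
        using fin E_sub[of k] True eq
        by (intro sum.mono_neutral_cong_right) (auto simp: g_def k_def)
      then show ?thesis using B lap eq by simp
    next
      case neq: False
      \<comment> \<open>For distinct vertices, the only edge incident with both is
        \<open>{x, y}\<close>, so the sum has at most one nonzero term.\<close>
      have "(\<Sum>e\<in>edges G. g e) =
          (\<Sum>e\<in>edges G. if e = {x, y} then (if {x, y} \<in> E k then - 1 else 0) else 0)"
        using True neq by (intro sum.cong refl) (simp add: g_def k_def)
      also have "\<dots> = (if {x, y} \<in> edges G then (if {x, y} \<in> E k then - 1 else 0) else 0)"
        using fin by (rule sum.delta)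
      also have "\<dots> = (if {x, y} \<in> E k then - 1 else 0)"
        using E_sub[of k] by auto
      finally show ?thesis using B lap neq by simp
    qed
  qed
  finally show "framework_laplacian d G p $$ (i, j) = ?B $$ (i, j)" .
qed (simp_all add: framework_laplacian_def rigidity_matrix_def)

text \<open>The characteristic polynomial is the product over the blocks, so the root multisets add
  up. Since \<open>kth_eigenvalue\<close> counts from 1, the indices \<open>d + 1\<close> and 2
  become list positions \<open>d\<close> and 1, as in the merging lemma.\<close>

lemma kth_eigenvalue_framework_laplacian:
  assumes G: "finite_simple_graph G" and p: "p \<in> frameworks d G"
    and d: "d > 0" and n: "card (verts G) \<ge> 2"
  shows "kth_eigenvalue (d + 1) (framework_laplacian d G p) =
    Min ((\<lambda>i. algebraic_connectivity (monochrome_subgraph i G p)) ` {..<d})"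
proof -
  define A where "A k = laplacian (monochrome_subgraph k G p)" for k
  have A: "A k \<in> carrier_mat (card (verts G)) (card (verts G))" for k
    using laplacian_carrier[of "monochrome_subgraph k G p"] by (simp add: A_def)
  have "char_poly (framework_laplacian d G p) = (\<Prod>k<d. char_poly (A k))"
    unfolding framework_laplacian_eq[OF G p d] A_def[symmetric]
    using A n d by (intro char_poly_interleaved_blocks) auto
  moreover have "char_poly (A k) \<noteq> 0" for k
    using degree_monic_char_poly[OF A[of k]] by auto
  ultimately have roots: "proots (char_poly (framework_laplacian d G p)) =
      (\<Sum>k<d. proots (char_poly (A k)))"
    by (simp add: proots_prod)
  note lap = proots_char_poly_laplacian[OF finite_simple_graph_monochrome_subgraph[OF G, of _ p],
      folded A_def]
  have "sorted_list_of_multiset (\<Sum>k<d. proots (char_poly (A k))) ! d =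
      Min ((\<lambda>k. sorted_list_of_multiset (proots (char_poly (A k))) ! 1) ` {..<d})"
    using n d lap by (intro sorted_list_of_multiset_sum_nth) auto
  then show ?thesis
    by (simp add: kth_eigenvalue_def algebraic_connectivity_def roots A_def)
qed

section \<open>Existence of frameworks, finiteness of the tuples, and the maximum\<close>

text \<open>Placing the vertices at distinct integers on the first coordinate axis works: the
  difference along any edge has coordinate 0 as its only nonzero coordinate.\<close>

lemma frameworks_nonempty:
  assumes G: "finite_simple_graph G" and d: "d > 0"
  shows "frameworks d G \<noteq> {}"
proof -
  have "finite (verts G)" using G by (simp add: finite_simple_graph_def)
  then obtain f :: "'a \<Rightarrow> nat" where f: "inj_on f (verts G)"
    using finite_imp_inj_to_nat_seg by blast
  define p where "p = restrict (\<lambda>v. vec d (\<lambda>i. if i = 0 then real (f v) else 0)) (verts G)"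
  have "p \<in> frameworks d G"
    unfolding frameworks_def
  proof (intro CollectI conjI allI impI)
    show "p \<in> verts G \<rightarrow>\<^sub>E carrier_vec d" by (auto simp: p_def)
  next
    fix v w assume e: "{v, w} \<in> edges G"
    then have vw: "v \<in> verts G" "w \<in> verts G" "v \<noteq> w"
      using G by (auto simp: finite_simple_graph_def)
    then have fvw: "f v \<noteq> f w" using f by (auto simp: inj_on_def)
    have diff: "(p v - p w) $ i = (if i = 0 then real (f v) - real (f w) else 0)" if "i < d" for i
      using vw that by (auto simp: p_def)
    have carr: "p v \<in> carrier_vec d" "p w \<in> carrier_vec d" using vw by (auto simp: p_def)
    have norm: "linf_norm (p v - p w) = \<bar>real (f v) - real (f w)\<bar>"
      unfolding linf_norm_def using carr d diff
      by (intro Max_eqI) (auto intro!: image_eqI[of _ _ 0])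
    show "p v \<noteq> p w"
    proof
      assume "p v = p w"
      then have "(p v - p w) $ 0 = 0" using carr d by simp
      with diff[OF d] fvw show False by simp
    qed
    show "\<exists>!i. i < d \<and> \<bar>(p v - p w) $ i\<bar> = linf_norm (p v - p w)"
    proof (rule ex1I[of _ 0])
      fix i assume "i < d \<and> \<bar>(p v - p w) $ i\<bar> = linf_norm (p v - p w)"
      then show "i = 0" using diff[of i] norm fvw by (auto split: if_splits)
    qed (use d diff norm in simp)
  qed
  then show ?thesis by blast
qed

text \<open>However many frameworks there are, every tuple is a list of length \<open>d\<close> of
  spanning subgraphs of \<open>G\<close>, and these form a finite set.\<close>

lemma finite_monochrome_tuples:
  assumes "finite_simple_graph G"
  shows "finite (monochrome_tuples d G)"
proof (rule finite_subset)
  let ?S = "{verts G} \<times> Pow (edges G)"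
  show "monochrome_tuples d G \<subseteq> {Gs. set Gs \<subseteq> ?S \<and> length Gs = d}"
    by (auto simp: monochrome_tuples_def monochrome_subgraph_def)
  show "finite {Gs. set Gs \<subseteq> ?S \<and> length Gs = d}"
    using finite_simple_graph_finite_edges[OF assms] by (intro finite_lists_length_eq) auto
qed

theorem theorem4p6:
  fixes G :: "'a graph" and d :: nat
  assumes "finite_simple_graph G"
    and "card (verts G) \<ge> d + 1"
    and "d \<ge> 2"
  shows "linf_algebraic_connectivity d G =
    Max ((\<lambda>Gs. Min ((\<lambda>i. algebraic_connectivity (Gs ! i)) ` {..<d})) ` monochrome_tuples d G)"
proof -
  let ?val = "\<lambda>Gs. Min ((\<lambda>i. algebraic_connectivity (Gs ! i)) ` {..<d})"
  let ?tuple = "\<lambda>p. map (\<lambda>i. monochrome_subgraph i G p) [0..<d]"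
  have tuples: "monochrome_tuples d G = ?tuple ` frameworks d G"
    by (auto simp: monochrome_tuples_def)
  \<comment> \<open>The eigenvalue depends on \<open>p\<close> only through its monochrome tuple, so
    the set under the supremum is the image of a finite set.\<close>
  have "kth_eigenvalue (d + 1) (framework_laplacian d G p) = ?val (?tuple p)"
    if "p \<in> frameworks d G" for p
  proof -
    have "?val (?tuple p) = Min ((\<lambda>i. algebraic_connectivity (monochrome_subgraph i G p)) ` {..<d})"
      by (intro arg_cong[of _ _ Min] image_cong) auto
    then show ?thesis
      using kth_eigenvalue_framework_laplacian[OF assms(1) that] assms(2,3) by simp
  qed
  then have "{kth_eigenvalue (d + 1) (framework_laplacian d G p) | p. p \<in> frameworks d G} =
      ?val ` monochrome_tuples d G"
    unfolding tuples by force
  then have "linf_algebraic_connectivity d G = Sup (?val ` monochrome_tuples d G)"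
    by (simp add: linf_algebraic_connectivity_def)
  \<comment> \<open>The real \<open>Sup\<close> agrees with \<open>Max\<close> on a finite nonempty
    set; nonemptiness comes from the existence of a framework.\<close>
  also have "\<dots> = Max (?val ` monochrome_tuples d G)"
  proof (rule cSup_eq_Max)
    show "finite (?val ` monochrome_tuples d G)"
      by (intro finite_imageI finite_monochrome_tuples assms)
    show "?val ` monochrome_tuples d G \<noteq> {}"
      using frameworks_nonempty[OF assms(1), of d] assms(3) by (simp add: tuples)
  qed
  finally show ?thesis .
qed

end
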